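(* Let $\kappa$ be a regular uncountable cardinal. For any countably complete uniform ultrafilter $U$ on $\kappa$, $\pi\mathfrak{ch}(U)\ge\mathfrak d_\kappa$ and $\pi\mathfrak t(U)\le\mathfrak b_\kappa$.
   Context: $A\subseteq^*B$ means $A\setminus\alpha\subseteq B$ for some $\alpha<\kappa$. A $\pi$-base for $U$ is a family $\mathcal B\subseteq[\kappa]^\kappa$ such that every $A\in U$ has some $B\in\mathcal B$ with $B\subseteq^*A$; $\pi\mathfrak{ch}(U)$ is the least size of a $\pi$-base. $\pi\mathfrak t(U)$ is the least regular cardinal $\lambda$ for which there is a $\subseteq^*$-decreasing sequence $\langle X_i:i<\lambda\rangle\subseteq U$ with no pseudo-intersection, i.e. no $Y\in[\kappa]^\kappa$ with $Y\subseteq^*X_i$ for all $i$. $\mathfrak b_\kappa$ ($\mathfrak d_\kappa$) is the least size of an unbounded (dominating) family in $({}^\kappa\kappa,\le^* )$, where $f\le^*g$ iff $f(\beta)\le g(\beta)$ for all sufficiently large $\beta<\kappa$. *)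

theory Defs
  imports "HOL-Library.Countable_Set"
begin

unbundle cardinal_syntax

text \<open>
  A cardinal \<open>\<kappa>\<close> is represented, as in the library, by a minimal well-order \<open>r\<close> (\<open>Card_order r\<close>).
  The ordinals below \<open>\<kappa>\<close> are the elements of \<open>Field r\<close>, the relation \<open>(\<alpha>, \<beta>) \<in> r\<close> is the
  non-strict order \<open>\<alpha> \<le> \<beta>\<close>, and the ordinal \<open>\<alpha>\<close>, as the set of its predecessors,
  is \<open>underS r \<alpha>\<close>.
\<close>

definition uncountable_regular :: "'k rel \<Rightarrow> bool" where
  "uncountable_regular r \<longleftrightarrow> Card_order r \<and> regularCard r \<and> natLeq <o r"

definition almost_subset :: "'k rel \<Rightarrow> 'k set \<Rightarrow> 'k set \<Rightarrow> bool" where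
  "almost_subset r A B \<longleftrightarrow> (\<exists>\<alpha> \<in> Field r. A - underS r \<alpha> \<subseteq> B)"

definition full_subsets :: "'k rel \<Rightarrow> 'k set set"  \<comment> \<open>\<open>[\<kappa>]\<^sup>\<kappa>\<close>\<close> where
  "full_subsets r = {A. A \<subseteq> Field r \<and> |A| =o r}"

definition ultrafilter_on :: "'k set \<Rightarrow> 'k set set \<Rightarrow> bool" where
  "ultrafilter_on S U \<longleftrightarrow>
     U \<subseteq> Pow S \<and> S \<in> U \<and> {} \<notin> U \<and>
     (\<forall>A\<in>U. \<forall>B\<in>U. A \<inter> B \<in> U) \<and>
     (\<forall>A\<in>U. \<forall>B. A \<subseteq> B \<and> B \<subseteq> S \<longrightarrow> B \<in> U) \<and>
     (\<forall>A. A \<subseteq> S \<longrightarrow> A \<in> U \<or> S - A \<in> U)"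

definition countably_complete :: "'k set set \<Rightarrow> bool" where
  "countably_complete U \<longleftrightarrow> (\<forall>C. C \<noteq> {} \<and> countable C \<and> C \<subseteq> U \<longrightarrow> \<Inter>C \<in> U)"

definition uniform_on :: "'k rel \<Rightarrow> 'k set set \<Rightarrow> bool" where
  "uniform_on r U \<longleftrightarrow> (\<forall>A\<in>U. |A| =o r)"

text \<open>The least cardinality of a set satisfying \<open>P\<close>, represented by a set attaining it.\<close>

definition least_size :: "('a set \<Rightarrow> bool) \<Rightarrow> 'a rel" where
  "least_size P = |SOME A. P A \<and> (\<forall>B. P B \<longrightarrow> |A| \<le>o |B| )|"

lemma least_size:
  assumes "P A"
  shows "\<exists>B. P B \<and> least_size P = |B|" and "\<And>B. P B \<Longrightarrow> least_size P \<le>o |B|"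
proof -
  obtain B where "P B" "\<forall>C. P C \<longrightarrow> |B| \<le>o |C|"
    using exists_minim_Card_order[of "card_of ` Collect P"] assms card_of_Card_order by auto
  then have "\<exists>B. P B \<and> (\<forall>C. P C \<longrightarrow> |B| \<le>o |C| )" by blast
  from someI_ex[OF this] show "\<exists>B. P B \<and> least_size P = |B|" "\<And>B. P B \<Longrightarrow> least_size P \<le>o |B|"
    unfolding least_size_def by auto
qed

definition pi_base :: "'k rel \<Rightarrow> 'k set set \<Rightarrow> 'k set set \<Rightarrow> bool" where
  "pi_base r U \<B> \<longleftrightarrow>
     \<B> \<subseteq> full_subsets r \<and> (\<forall>A\<in>U. \<exists>B\<in>\<B>. almost_subset r B A)"

definition pi_character :: "'k rel \<Rightarrow> 'k set set \<Rightarrow> 'k set rel" where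
  "pi_character r U = least_size (pi_base r U)"

definition le_star :: "'k rel \<Rightarrow> ('k \<Rightarrow> 'k) \<Rightarrow> ('k \<Rightarrow> 'k) \<Rightarrow> bool" where
  "le_star r f g \<longleftrightarrow> (\<exists>\<alpha> \<in> Field r. \<forall>\<beta> \<in> Field r. (\<alpha>, \<beta>) \<in> r \<longrightarrow> (f \<beta>, g \<beta>) \<in> r)"

text \<open>
  \<open>Func (Field r) (Field r)\<close> is \<open>\<^sup>\<kappa>\<kappa>\<close>; its members take the value \<open>undefined\<close> off \<open>Field r\<close>.
\<close>

definition unbounded_family :: "'k rel \<Rightarrow> ('k \<Rightarrow> 'k) set \<Rightarrow> bool" where
  "unbounded_family r F \<longleftrightarrow>
     F \<subseteq> Func (Field r) (Field r) \<and>
     \<not> (\<exists>g \<in> Func (Field r) (Field r). \<forall>f\<in>F. le_star r f g)"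

definition dominating_family :: "'k rel \<Rightarrow> ('k \<Rightarrow> 'k) set \<Rightarrow> bool" where
  "dominating_family r F \<longleftrightarrow>
     F \<subseteq> Func (Field r) (Field r) \<and>
     (\<forall>g \<in> Func (Field r) (Field r). \<exists>f\<in>F. le_star r g f)"

definition bounding_number :: "'k rel \<Rightarrow> ('k \<Rightarrow> 'k) rel" where
  "bounding_number r = least_size (unbounded_family r)"

definition dominating_number :: "'k rel \<Rightarrow> ('k \<Rightarrow> 'k) rel" where
  "dominating_number r = least_size (dominating_family r)"

definition pseudo_intersection :: "'k rel \<Rightarrow> 'l set \<Rightarrow> ('l \<Rightarrow> 'k set) \<Rightarrow> 'k set \<Rightarrow> bool" where
  "pseudo_intersection r I X Y \<longleftrightarrow> Y \<in> full_subsets r \<and> (\<forall>i\<in>I. almost_subset r Y (X i))"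

definition tower_length :: "'k rel \<Rightarrow> 'k set set \<Rightarrow> 'l rel \<Rightarrow> bool" where
  "tower_length r U l \<longleftrightarrow>
     Cinfinite l \<and> regularCard l \<and>
     (\<exists>X. (\<forall>i \<in> Field l. X i \<in> U) \<and>
          (\<forall>i j. (i, j) \<in> l \<longrightarrow> almost_subset r (X j) (X i)) \<and>
          \<not> (\<exists>Y. pseudo_intersection r (Field l) X Y))"

text \<open>
  \<open>is_pi_tightness r U l\<close> says that \<open>l\<close> is the least such length; it determines \<open>l\<close> up to \<open>=o\<close>.
  It is stated as a predicate because, unlike for the other invariants, it is not evident that
  there is any such length. The lengths are compared among the cardinals on the type \<open>'k set\<close>;
  this loses none, by the following lemma.
\<close>

definition is_pi_tightness :: "'k rel \<Rightarrow> 'k set set \<Rightarrow> 'k set rel \<Rightarrow> bool" where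
  "is_pi_tightness r U l \<longleftrightarrow>
     tower_length r U l \<and> (\<forall>l' :: 'k set rel. tower_length r U l' \<longrightarrow> l \<le>o l')"

lemma tower_length_le:
  fixes r :: "'k rel" and l :: "'l rel"
  assumes U: "U \<subseteq> Pow (Field r)" "uniform_on r U" and l: "tower_length r U l"
  shows "l \<le>o |UNIV :: 'k set set|"
proof (rule ccontr)
  assume not: "\<not> l \<le>o |UNIV :: 'k set set|"
  have lC: "Card_order l" "\<not> finite (Field l)" "regularCard l"
    using l unfolding tower_length_def cinfinite_def by auto
  then have wl: "wo_rel l"
    unfolding card_order_on_def wo_rel_def by blast
  obtain X where X: "\<And>i. i \<in> Field l \<Longrightarrow> X i \<in> U"
      "\<And>i j. (i, j) \<in> l \<Longrightarrow> almost_subset r (X j) (X i)"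
      "\<not> (\<exists>Y. pseudo_intersection r (Field l) X Y)"
    using l unfolding tower_length_def by blast
  have bd: "\<exists>a. a \<in> Field l \<and> (\<forall>i\<in>Field l. X i = A \<longrightarrow> (i, a) \<in> l)" if A: "A \<in> X ` Field l" for A
  proof -
    have "\<not> cofinal {i \<in> Field l. X i = A} l"
    proof
      assume c: "cofinal {i \<in> Field l. X i = A} l"
      have "A \<in> full_subsets r"
        using A X(1) U unfolding full_subsets_def uniform_on_def by auto
      moreover have "almost_subset r A (X i)" if "i \<in> Field l" for i
        using c that X(2) unfolding cofinal_def by auto
      ultimately show False using X(3) unfolding pseudo_intersection_def by blast
    qed
    then obtain a where "a \<in> Field l" "\<forall>b\<in>Field l. X b = A \<longrightarrow> a = b \<or> (a, b) \<notin> l"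
      unfolding cofinal_def by blast
    then show ?thesis
      using wo_rel.TOTALS[OF wl] by blast
  qed
  define b where "b A = (SOME a. a \<in> Field l \<and> (\<forall>i\<in>Field l. X i = A \<longrightarrow> (i, a) \<in> l))" for A
  have b: "b A \<in> Field l" "\<And>i. i \<in> Field l \<Longrightarrow> X i = A \<Longrightarrow> (i, b A) \<in> l" if "A \<in> X ` Field l" for A
    using someI_ex[OF bd[OF that]] unfolding b_def by auto
  have "cofinal (b ` X ` Field l) l"
    unfolding cofinal_def
  proof
    fix a assume "a \<in> Field l"
    then obtain a' where a': "a' \<in> Field l" "a \<noteq> a'" "(a, a') \<in> l"
      using infinite_Card_order_limit[OF lC(1,2)] by blast
    then have "(a', b (X a')) \<in> l" using b(2) by blast
    moreover have "(a, b (X a')) \<in> l" "a \<noteq> b (X a')"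
      using a' calculation wo_rel.TRANS[OF wl] wo_rel.ANTISYM[OF wl]
      unfolding trans_def antisym_def by blast+
    ultimately show "\<exists>c\<in>b ` X ` Field l. a \<noteq> c \<and> (a, c) \<in> l" using a' by blast
  qed
  moreover have "b ` X ` Field l \<subseteq> Field l" using b by blast
  ultimately have "|b ` X ` Field l| =o l"
    using lC(3) unfolding regularCard_def by blast
  moreover have "|b ` X ` Field l| \<le>o |UNIV :: 'k set set|"
    using card_of_image[of b "X ` Field l"] card_of_mono1[of "X ` Field l" UNIV]
      ordLeq_transitive by blast
  ultimately show False
    using not ordIso_ordLeq_trans ordIso_symmetric by blast
qed

end

theory Submission
  imports Defs
begin

text \<open>
  For \<open>g : \<kappa> \<rightarrow> \<kappa>\<close> let \<open>C\<^sub>g\<close> be the club of closure points of \<open>g\<close> and \<open>h\<^sub>g(\<beta>)\<close> the greatest element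
  of \<open>C\<^sub>g\<close> below or at \<open>\<beta>\<close>. By countable completeness some \<open>h = h\<^sub>g\<close> has least class in the ultrapower,
  and then \<open>h\<inverse>[C\<^sub>f] \<in> U\<close> for every \<open>f\<close>. Since \<open>h\<close> is monotone and unbounded, a set \<open>Y\<close> of size \<open>\<kappa>\<close> with
  \<open>Y \<subseteq>\<^sup>* h\<inverse>[C\<^sub>f]\<close> has \<open>h[Y] \<subseteq>\<^sup>* C\<^sub>f\<close>, so the function taking \<open>\<xi>\<close> to a larger element of \<open>h[Y]\<close>
  eventually dominates \<open>f\<close>. Thus a \<open>\<pi>\<close>-base yields a dominating family, and for an unbounded
  \<open>\<le>\<^sup>*\<close>-increasing sequence \<open>f\<^sub>i\<close> of length the bounding number, the sets \<open>h\<inverse>[C\<^bsub>f i\<^esub>]\<close>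
  form a tower without pseudo-intersection.
\<close>

section \<open>The order on \<kappa> and bounds from regularity\<close>

locale uncountable_regular_cardinal =
  fixes r :: "'k rel"
  assumes uncountable_regular: "uncountable_regular r"
begin

abbreviation le (infix "\<preceq>" 50) where "x \<preceq> y \<equiv> (x, y) \<in> r"
abbreviation lt (infix "\<prec>" 50) where "x \<prec> y \<equiv> x \<in> underS r y"
abbreviation "\<kappa> \<equiv> Field r"

lemma Card_order: "Card_order r"
  and regular: "regularCard r"
  and uncountable: "natLeq <o r"
  using uncountable_regular by (auto simp: uncountable_regular_def)

lemma wo_rel: "wo_rel r"
  using Card_order by (auto simp: card_order_on_def wo_rel_def)

lemma infinite_Field: "infinite \<kappa>"
  using Card_order uncountable natLeq_Card_order Field_natLeq
  by (metis card_of_Field_ordIso card_of_ordLeq_finite infinite_UNIV_nat ordIso_symmetric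
      ordLeq_ordIso_trans ordIso_ordLeq_trans ordLess_imp_ordLeq)

lemma lt_iff: "x \<prec> y \<longleftrightarrow> x \<preceq> y \<and> x \<noteq> y"
  by (auto simp: underS_def)

lemma le_in_Field: "x \<preceq> y \<Longrightarrow> x \<in> \<kappa>" "x \<preceq> y \<Longrightarrow> y \<in> \<kappa>"
  by (auto simp: Field_def)

lemma le_refl: "x \<in> \<kappa> \<Longrightarrow> x \<preceq> x"
  using wo_rel.REFL[OF wo_rel] by (auto simp: refl_on_def)

lemma le_trans [trans]: "x \<preceq> y \<Longrightarrow> y \<preceq> z \<Longrightarrow> x \<preceq> z"
  using wo_rel.TRANS[OF wo_rel] by (auto simp: trans_def)

lemma le_antisym: "x \<preceq> y \<Longrightarrow> y \<preceq> x \<Longrightarrow> x = y"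
  using wo_rel.ANTISYM[OF wo_rel] by (auto simp: antisym_def)

lemma lt_le_trans [trans]: "x \<prec> y \<Longrightarrow> y \<preceq> z \<Longrightarrow> x \<prec> z"
  and le_lt_trans [trans]: "x \<preceq> y \<Longrightarrow> y \<prec> z \<Longrightarrow> x \<prec> z"
  unfolding lt_iff using le_trans le_antisym by blast+

lemma not_lt: "x \<in> \<kappa> \<Longrightarrow> y \<in> \<kappa> \<Longrightarrow> \<not> x \<prec> y \<longleftrightarrow> y \<preceq> x"
  unfolding lt_iff using wo_rel.TOTALS[OF wo_rel] le_antisym le_refl by blast

lemma wf: "wf (r - Id)"
  using wo_rel.WELL[OF wo_rel] by (auto simp: well_order_on_def)

lemma exists_greater: "x \<in> \<kappa> \<Longrightarrow> \<exists>y\<in>\<kappa>. x \<prec> y"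
  using infinite_Card_order_limit[OF Card_order infinite_Field] by (auto simp: lt_iff)

text \<open>Regularity makes a small set non-cofinal, so some element bounds it weakly; passing to a
  larger element makes the bound strict.\<close>

lemma bounded_if_small:
  assumes "K \<subseteq> \<kappa>" "|K| <o r"
  shows "\<exists>a\<in>\<kappa>. \<forall>k\<in>K. k \<prec> a"
proof -
  have "\<not> cofinal K r"
    using assms regular not_ordLess_ordIso by (auto simp: regularCard_def)
  then obtain a where a: "a \<in> \<kappa>" "\<And>k. k \<in> K \<Longrightarrow> \<not> a \<prec> k"
    by (auto simp: cofinal_def lt_iff)
  obtain b where "b \<in> \<kappa>" "a \<prec> b"
    using exists_greater[OF a(1)] by blast
  then show ?thesis
    using a assms(1) not_lt le_lt_trans by (meson subsetD)
qed

lemma underS_small: "x \<in> \<kappa> \<Longrightarrow> |underS r x| <o r"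
  using card_of_underS[OF Card_order] .

lemma bounded_image_underS:
  assumes "x \<in> \<kappa>" "\<And>y. y \<in> \<kappa> \<Longrightarrow> g y \<in> \<kappa>"
  shows "\<exists>a\<in>\<kappa>. \<forall>y. y \<prec> x \<longrightarrow> g y \<prec> a"
proof -
  have "|g ` underS r x| <o r"
    using card_of_image underS_small[OF assms(1)] ordLeq_ordLess_trans by blast
  moreover have "g ` underS r x \<subseteq> \<kappa>"
    using assms(2) le_in_Field(1) lt_iff by blast
  ultimately show ?thesis
    using bounded_if_small[of "g ` underS r x"] by blast
qed

lemma bounded_sequence:
  fixes a :: "nat \<Rightarrow> 'k"
  assumes "\<And>n. a n \<in> \<kappa>"
  shows "\<exists>b\<in>\<kappa>. \<forall>n. a n \<prec> b"
proof -
  have "|range a| <o r"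
    using card_of_image card_of_nat uncountable
    by (metis ordIso_ordLess_trans ordLeq_ordLess_trans)
  then show ?thesis
    using bounded_if_small[of "range a"] assms by blast
qed

text \<open>Well-foundedness picks the least weak upper bound; anything below it fails to bound
  \<open>S\<close>. An empty \<open>S\<close> is allowed and yields the least element of
  \<kappa>.\<close>

lemma least_upper_bound:
  assumes "b \<in> \<kappa>" "\<And>x. x \<in> S \<Longrightarrow> x \<preceq> b"
  shows "\<exists>s\<in>\<kappa>. s \<preceq> b \<and> (\<forall>x\<in>S. x \<preceq> s) \<and> (\<forall>\<xi>. \<xi> \<prec> s \<longrightarrow> (\<exists>x\<in>S. \<xi> \<prec> x))"
proof -
  let ?B = "{s\<in>\<kappa>. \<forall>x\<in>S. x \<preceq> s}"
  have "b \<in> ?B" using assms by blast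
  then obtain s where s: "s \<in> ?B" "\<And>y. y \<prec> s \<Longrightarrow> y \<notin> ?B"
    using wf unfolding wf_eq_minimal lt_iff by (metis (no_types, lifting) DiffI pair_in_Id_conv)
  have "s \<preceq> b"
    using s \<open>b \<in> ?B\<close> assms(1) not_lt by blast
  moreover have "\<exists>x\<in>S. \<xi> \<prec> x" if "\<xi> \<prec> s" for \<xi>
  proof -
    have "\<xi> \<in> \<kappa>" using that le_in_Field by (auto simp: lt_iff)
    then show ?thesis
      using s(2)[OF that] assms(2) not_lt le_in_Field by blast
  qed
  ultimately show ?thesis using s(1) by blast
qed

lemma full_subset_unbounded:
  assumes "Y \<in> full_subsets r" "a \<in> \<kappa>"
  shows "\<exists>y\<in>Y. a \<preceq> y"
proof (rule ccontr)
  assume "\<not> ?thesis"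
  then have "Y \<subseteq> underS r a"
    using assms not_lt unfolding full_subsets_def by blast
  then have "|Y| <o r"
    using underS_small[OF assms(2)] card_of_mono1 ordLeq_ordLess_trans by blast
  then show False
    using assms(1) not_ordLess_ordIso unfolding full_subsets_def by blast
qed

section \<open>Closure points of a function\<close>

text \<open>The least element of \<kappa> belongs vacuously, so every element has a closure point at
  or below it.\<close>

definition closure_points :: "('k \<Rightarrow> 'k) \<Rightarrow> 'k set" where
  "closure_points g = {\<delta>\<in>\<kappa>. \<forall>\<xi>. \<xi> \<prec> \<delta> \<longrightarrow> g \<xi> \<prec> \<delta>}"

text \<open>Iterating \<open>s\<close> from \<open>a\<close> gives an \<omega>-sequence, bounded in
  \<kappa> because \<kappa> is regular and uncountable. An element below its supremum is below some
  \<open>A n\<close>, so its value under \<open>g\<close> is below \<open>A (Suc n)\<close>.\<close>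

lemma closure_points_unbounded:
  assumes g: "\<And>x. x \<in> \<kappa> \<Longrightarrow> g x \<in> \<kappa>" and "a \<in> \<kappa>"
  shows "\<exists>\<delta>\<in>closure_points g. a \<prec> \<delta>"
proof -
  \<comment> \<open>The larger of \<open>u\<close> and \<open>v\<close> is taken: \<open>u\<close>
    bounds \<open>g\<close> on the segment below \<open>x\<close>, and \<open>v\<close> lies beyond
    \<open>x\<close>.\<close>
  have "\<exists>y. x \<in> \<kappa> \<longrightarrow> x \<prec> y \<and> y \<in> \<kappa> \<and> (\<forall>z. z \<prec> x \<longrightarrow> g z \<prec> y)" for x
  proof (cases "x \<in> \<kappa>")
    case True
    obtain u v where "u \<in> \<kappa>" "\<forall>z. z \<prec> x \<longrightarrow> g z \<prec> u" "v \<in> \<kappa>" "x \<prec> v"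
      using bounded_image_underS[OF True] g exists_greater[OF True] by blast
    then show ?thesis
      using not_lt[of u v] lt_le_trans by (metis lt_iff)
  qed simp
  then obtain s where s: "\<And>x. x \<in> \<kappa> \<Longrightarrow> x \<prec> s x \<and> s x \<in> \<kappa> \<and> (\<forall>z. z \<prec> x \<longrightarrow> g z \<prec> s x)"
    by metis
  define A where "A n = (s ^^ n) a" for n
  have A: "A n \<in> \<kappa>" for n
    by (induction n) (use assms(2) s in \<open>auto simp: A_def\<close>)
  have A_Suc: "A (Suc n) = s (A n)" for n
    by (simp add: A_def)
  obtain b where "b \<in> \<kappa>" "\<And>n. A n \<prec> b"
    using bounded_sequence A by blast
  then obtain \<delta> where \<delta>: "\<delta> \<in> \<kappa>" "\<And>n. A n \<preceq> \<delta>" "\<And>\<xi>. \<xi> \<prec> \<delta> \<Longrightarrow> \<exists>n. \<xi> \<prec> A n"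
    using least_upper_bound[of b "range A"] by (auto simp: lt_iff)
  have "a \<prec> \<delta>"
    using s[OF A[of 0]] \<delta>(2)[of 1] lt_le_trans by (auto simp: A_def)
  moreover have "g \<xi> \<prec> \<delta>" if "\<xi> \<prec> \<delta>" for \<xi>
    using \<delta>(2,3) that s[OF A] A_Suc lt_le_trans by metis
  ultimately show ?thesis
    using \<delta>(1) by (auto simp: closure_points_def)
qed

text \<open>Closure points form a closed set: anything under the supremum of those up to
  \<open>b\<close> is already under one of them.\<close>

lemma exists_greatest_closure_point:
  assumes "b \<in> \<kappa>"
  shows "\<exists>\<delta>\<in>closure_points g. \<delta> \<preceq> b \<and> (\<forall>\<gamma>\<in>closure_points g. \<gamma> \<preceq> b \<longrightarrow> \<gamma> \<preceq> \<delta>)"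
proof -
  let ?S = "{\<gamma>\<in>closure_points g. \<gamma> \<preceq> b}"
  obtain s where s: "s \<in> \<kappa>" "s \<preceq> b" "\<And>x. x \<in> ?S \<Longrightarrow> x \<preceq> s"
      "\<And>\<xi>. \<xi> \<prec> s \<Longrightarrow> \<exists>x\<in>?S. \<xi> \<prec> x"
    using least_upper_bound[OF assms, of ?S] by blast
  have "g \<xi> \<prec> s" if \<xi>: "\<xi> \<prec> s" for \<xi>
  proof -
    obtain x where x: "x \<in> ?S" "\<xi> \<prec> x"
      using s(4)[OF \<xi>] by blast
    then show ?thesis
      using lt_le_trans[OF _ s(3)[OF x(1)]] by (simp add: closure_points_def)
  qed
  then have "s \<in> closure_points g"
    using s(1) by (auto simp: closure_points_def)
  then show ?thesis using s(2,3) by blast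
qed

text \<open>The map \<open>h\<^sub>g\<close>. The choice is unique for
  \<open>b \<in> \<kappa>\<close> and arbitrary elsewhere.\<close>

definition last_closure_point :: "('k \<Rightarrow> 'k) \<Rightarrow> 'k \<Rightarrow> 'k" where
  "last_closure_point g b = (SOME \<delta>. \<delta> \<in> closure_points g \<and> \<delta> \<preceq> b \<and>
     (\<forall>\<gamma>\<in>closure_points g. \<gamma> \<preceq> b \<longrightarrow> \<gamma> \<preceq> \<delta>))"

lemma last_closure_point:
  assumes "b \<in> \<kappa>"
  shows "last_closure_point g b \<in> closure_points g" "last_closure_point g b \<preceq> b"
    and "\<And>\<gamma>. \<gamma> \<in> closure_points g \<Longrightarrow> \<gamma> \<preceq> b \<Longrightarrow> \<gamma> \<preceq> last_closure_point g b"
proof -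
  have "\<exists>\<delta>. \<delta> \<in> closure_points g \<and> \<delta> \<preceq> b \<and> (\<forall>\<gamma>\<in>closure_points g. \<gamma> \<preceq> b \<longrightarrow> \<gamma> \<preceq> \<delta>)"
    using exists_greatest_closure_point[OF assms] by blast
  from someI_ex[OF this]
  show "last_closure_point g b \<in> closure_points g" "last_closure_point g b \<preceq> b"
    "\<And>\<gamma>. \<gamma> \<in> closure_points g \<Longrightarrow> \<gamma> \<preceq> b \<Longrightarrow> \<gamma> \<preceq> last_closure_point g b"
    unfolding last_closure_point_def by blast+
qed

lemma last_closure_point_mono:
  assumes "a \<preceq> b"
  shows "last_closure_point g a \<preceq> last_closure_point g b"
  using assms last_closure_point le_trans le_in_Field by meson

lemma last_closure_point_in_Field: "b \<in> \<kappa> \<Longrightarrow> last_closure_point g b \<in> \<kappa>"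
  using last_closure_point(2) le_in_Field by blast

text \<open>A closure point \<delta> above \<open>a\<close> serves as \<open>b\<close>, since it is
  itself a candidate for the last closure point of every later \<open>x\<close>.\<close>

lemma last_closure_point_unbounded:
  assumes g: "\<And>x. x \<in> \<kappa> \<Longrightarrow> g x \<in> \<kappa>" and "a \<in> \<kappa>"
  shows "\<exists>b\<in>\<kappa>. \<forall>x. b \<preceq> x \<longrightarrow> a \<prec> last_closure_point g x"
proof -
  obtain \<delta> where \<delta>: "\<delta> \<in> closure_points g" "a \<prec> \<delta>"
    using closure_points_unbounded[of g a] assms by blast
  then have "\<forall>x. \<delta> \<preceq> x \<longrightarrow> a \<prec> last_closure_point g x"
    using last_closure_point(3) le_in_Field(2) lt_le_trans by meson
  then show ?thesis
    using \<delta>(1) unfolding closure_points_def by blast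
qed

section \<open>Pointwise maxima and eventual domination\<close>

definition pointwise_max :: "('k \<Rightarrow> 'k) \<Rightarrow> ('k \<Rightarrow> 'k) \<Rightarrow> 'k \<Rightarrow> 'k" where
  "pointwise_max f g x = (if f x \<preceq> g x then g x else f x)"

text \<open>Off \<kappa> both functions are \<open>undefined\<close>, so either branch keeps the
  default value.\<close>

lemma pointwise_max_Func:
  "f \<in> Func \<kappa> \<kappa> \<Longrightarrow> g \<in> Func \<kappa> \<kappa> \<Longrightarrow> pointwise_max f g \<in> Func \<kappa> \<kappa>"
  by (auto simp: Func_def pointwise_max_def)

lemma pointwise_max_ge:
  assumes "f \<in> Func \<kappa> \<kappa>" "g \<in> Func \<kappa> \<kappa>" "x \<in> \<kappa>"
  shows "f x \<preceq> pointwise_max f g x" "g x \<preceq> pointwise_max f g x"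
  using assms not_lt[of "f x" "g x"] le_refl by (auto simp: Func_def pointwise_max_def lt_iff)

lemma closure_points_antimono:
  assumes "\<And>x. x \<in> \<kappa> \<Longrightarrow> f x \<preceq> g x"
  shows "closure_points g \<subseteq> closure_points f"
  using assms le_lt_trans lt_iff le_in_Field(1) unfolding closure_points_def by blast

lemma le_star_trans [trans]:
  assumes "le_star r f g" "le_star r g h"
  shows "le_star r f h"
proof -
  obtain a b where ab: "a \<in> \<kappa>" "b \<in> \<kappa>" "\<And>x. a \<preceq> x \<Longrightarrow> f x \<preceq> g x" "\<And>x. b \<preceq> x \<Longrightarrow> g x \<preceq> h x"
    using assms le_in_Field unfolding le_star_def by metis
  define c where "c = (if a \<preceq> b then b else a)"
  have "c \<in> \<kappa>" "a \<preceq> c" "b \<preceq> c"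
    using ab(1,2) not_lt[of a b] le_refl by (auto simp: c_def lt_iff)
  then show ?thesis
    using ab(3,4) le_trans unfolding le_star_def by meson
qed

lemma le_star_if_le:
  assumes "\<And>x. x \<in> \<kappa> \<Longrightarrow> f x \<preceq> g x"
  shows "le_star r f g"
  using assms infinite_Field unfolding le_star_def by (metis ex_in_conv finite.emptyI)

text \<open>Below \<open>a\<close> the function \<open>f\<close> may exceed \<open>g\<close>, but
  regularity bounds its values there by some \<open>c\<close>, and closure points beyond
  \<open>c\<close> absorb them.\<close>

lemma closure_points_almost_antimono:
  assumes "le_star r f g" and f: "\<And>x. x \<in> \<kappa> \<Longrightarrow> f x \<in> \<kappa>"
  shows "\<exists>c\<in>\<kappa>. \<forall>\<delta>\<in>closure_points g. c \<prec> \<delta> \<longrightarrow> \<delta> \<in> closure_points f"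
proof -
  obtain a where a: "a \<in> \<kappa>" "\<And>x. a \<preceq> x \<Longrightarrow> f x \<preceq> g x"
    using assms le_in_Field unfolding le_star_def by metis
  obtain c where c: "c \<in> \<kappa>" "\<And>x. x \<prec> a \<Longrightarrow> f x \<prec> c"
    using bounded_image_underS[OF a(1)] f by blast
  have "\<delta> \<in> closure_points f" if \<delta>: "\<delta> \<in> closure_points g" "c \<prec> \<delta>" for \<delta>
  proof -
    have "f \<xi> \<prec> \<delta>" if \<xi>: "\<xi> \<prec> \<delta>" for \<xi>
    proof (cases "\<xi> \<prec> a")
      case True
      then show ?thesis using c(2) \<delta>(2) lt_le_trans lt_iff by blast
    next
      case False
      then have "f \<xi> \<preceq> g \<xi>"
        using a not_lt \<xi> le_in_Field lt_iff by blast
      then show ?thesis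
        using \<delta>(1) \<xi> le_lt_trans unfolding closure_points_def by blast
    qed
    then show ?thesis using \<delta>(1) by (simp add: closure_points_def)
  qed
  then show ?thesis using c(1) by blast
qed

section \<open>The bounding number and increasing unbounded sequences\<close>

text \<open>Some unbounded family must exist for the least size to be attained. A strict pointwise
  majorant \<open>f\<close> of \<open>g\<close> defeats \<open>g\<close>.\<close>

lemma unbounded_family_Func: "unbounded_family r (Func \<kappa> \<kappa>)"
proof -
  have "\<exists>f\<in>Func \<kappa> \<kappa>. \<not> le_star r f g" if g: "g \<in> Func \<kappa> \<kappa>" for g
  proof -
    have "\<forall>x\<in>\<kappa>. \<exists>y\<in>\<kappa>. g x \<prec> y"
      using g exists_greater by (auto simp: Func_def)
    then obtain s where s: "\<And>x. x \<in> \<kappa> \<Longrightarrow> s x \<in> \<kappa> \<and> g x \<prec> s x"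
      by metis
    define f where "f x = (if x \<in> \<kappa> then s x else undefined)" for x
    have "\<not> le_star r f g"
    proof
      assume "le_star r f g"
      then obtain a where "a \<in> \<kappa>" "f a \<preceq> g a"
        using le_refl unfolding le_star_def by blast
      then show False
        using s[of a] le_antisym by (auto simp: f_def lt_iff)
    qed
    moreover have "f \<in> Func \<kappa> \<kappa>"
      using s by (auto simp: f_def Func_def)
    ultimately show ?thesis by blast
  qed
  then show ?thesis by (auto simp: unbounded_family_def)
qed

lemma bounded_if_less_bounding_number:
  assumes "G \<subseteq> Func \<kappa> \<kappa>" "|G| <o bounding_number r"
  shows "\<exists>g\<in>Func \<kappa> \<kappa>. \<forall>f\<in>G. le_star r f g"
  using least_size(2)[of "unbounded_family r", OF unbounded_family_Func, of G] assms
    not_ordLeq_ordLess unfolding bounding_number_def unbounded_family_def by blast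

text \<open>Shows that unbounded families are infinite; the case of empty \<open>G\<close> also
  supplies a member of \<open>Func \<kappa> \<kappa>\<close>.\<close>

lemma finite_bounded:
  assumes "finite G" "G \<subseteq> Func \<kappa> \<kappa>"
  shows "\<exists>g\<in>Func \<kappa> \<kappa>. \<forall>f\<in>G. le_star r f g"
  using assms
proof (induction G rule: finite_induct)
  case empty
  obtain a where "a \<in> \<kappa>" using infinite_Field by (metis ex_in_conv finite.emptyI)
  then have "(\<lambda>x. if x \<in> \<kappa> then a else undefined) \<in> Func \<kappa> \<kappa>" by (auto simp: Func_def)
  then show ?case by blast
next
  case (insert f G)
  then obtain g where g: "g \<in> Func \<kappa> \<kappa>" "\<And>f. f \<in> G \<Longrightarrow> le_star r f g" and f: "f \<in> Func \<kappa> \<kappa>"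
    by auto
  have "le_star r f (pointwise_max f g)" "le_star r g (pointwise_max f g)"
    using pointwise_max_ge[OF f g(1)] le_star_if_le by blast+
  then show ?case
    using g le_star_trans pointwise_max_Func[OF f g(1)] by blast
qed

text \<open>A least unbounded family is enumerated along \<open>l\<close> by \<open>e\<close> and
  made increasing by recursion. The type of \<open>l\<close> is arbitrary because tower lengths are
  compared on a type other than that of functions.\<close>

lemma bounding_scale:
  fixes l :: "'l rel"
  assumes "Card_order l" "l =o bounding_number r"
  shows "Cinfinite l" "regularCard l"
    and "\<exists>g. (\<forall>i\<in>Field l. g i \<in> Func \<kappa> \<kappa>) \<and> (\<forall>i j. (i, j) \<in> l \<longrightarrow> le_star r (g i) (g j)) \<and>
      \<not> (\<exists>h\<in>Func \<kappa> \<kappa>. \<forall>i\<in>Field l. le_star r (g i) h)"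
proof -
  have wl: "wo_rel l"
    using assms(1) by (auto simp: card_order_on_def wo_rel_def)
  obtain F where F: "unbounded_family r F" "bounding_number r = |F|"
    using least_size(1)[of "unbounded_family r", OF unbounded_family_Func]
    unfolding bounding_number_def by blast
  have "infinite F"
    using finite_bounded F(1) unfolding unbounded_family_def by blast
  moreover have lF: "|Field l| =o |F|"
    using assms F(2) card_of_Field_ordIso ordIso_transitive by metis
  ultimately show Cinf: "Cinfinite l"
    using assms(1) card_of_ordIso_finite by (auto simp: cinfinite_def)
  obtain e where e: "bij_betw e (Field l) F"
    using lF card_of_ordIso by blast
  then have e_Func: "e i \<in> Func \<kappa> \<kappa>" if "i \<in> Field l" for i
    using that F(1) unfolding unbounded_family_def bij_betw_def by blast
  \<comment> \<open>By minimality of the bounding number; both the recursion and the regularity of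
    \<open>l\<close> rest on this bound.\<close>
  have small: "\<exists>g\<in>Func \<kappa> \<kappa>. \<forall>k\<in>K. le_star r (f k) g"
    if "|K| <o l" "\<And>k. k \<in> K \<Longrightarrow> f k \<in> Func \<kappa> \<kappa>" for K and f :: "'l \<Rightarrow> 'k \<Rightarrow> 'k"
  proof -
    have "|f ` K| <o bounding_number r"
      using that(1) assms(2) card_of_image ordLeq_ordLess_trans ordLess_ordIso_trans by metis
    then show ?thesis
      using bounded_if_less_bounding_number[of "f ` K"] that(2) by blast
  qed
  define step where "step G i = (SOME h. h \<in> Func \<kappa> \<kappa> \<and> le_star r (e i) h \<and>
      (\<forall>j\<in>underS l i. le_star r (G j) h))" for G i
  define g where "g = wfrec (l - Id) step"
  have wf_l: "wf (l - Id)"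
    using wo_rel.WELL[OF wl] by (auto simp: well_order_on_def)
  \<comment> \<open>The recursion consults \<open>G\<close> only at strict predecessors of
    \<open>i\<close>.\<close>
  have "adm_wf (l - Id) step"
    unfolding adm_wf_def step_def underS_def by (auto intro!: arg_cong[where f = Eps])
  then have g_eq: "g i = step g i" for i
    using wfrec_fixpoint[OF wf_l] unfolding g_def by metis
  have g: "i \<in> Field l \<longrightarrow> g i \<in> Func \<kappa> \<kappa> \<and> le_star r (e i) (g i) \<and>
      (\<forall>j\<in>underS l i. le_star r (g j) (g i))" for i
  proof (induction i rule: wf_induct_rule[OF wf_l])
    case (1 i)
    show ?case
    proof
      assume i: "i \<in> Field l"
      have "g j \<in> Func \<kappa> \<kappa>" if "j \<in> underS l i" for j
        using 1[of j] that by (auto simp: underS_def Field_def)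
      \<comment> \<open>Proper initial segments of a cardinal are smaller than it, so the earlier
        terms have a common bound \<open>h\<close>; its maximum with \<open>e i\<close> is a
        possible next term.\<close>
      then obtain h where h: "h \<in> Func \<kappa> \<kappa>" "\<And>j. j \<in> underS l i \<Longrightarrow> le_star r (g j) h"
        using small[OF card_of_underS[OF assms(1) i], of g] by blast
      have "le_star r (e i) (pointwise_max (e i) h)" "le_star r h (pointwise_max (e i) h)"
        using pointwise_max_ge[OF e_Func[OF i] h(1)] le_star_if_le by blast+
      then have "\<exists>h. h \<in> Func \<kappa> \<kappa> \<and> le_star r (e i) h \<and> (\<forall>j\<in>underS l i. le_star r (g j) h)"
        using pointwise_max_Func[OF e_Func[OF i] h(1)] h(2) le_star_trans by blast
      from someI_ex[OF this] show "g i \<in> Func \<kappa> \<kappa> \<and> le_star r (e i) (g i) \<and>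
          (\<forall>j\<in>underS l i. le_star r (g j) (g i))"
        unfolding g_eq[of i] step_def .
    qed
  qed
  have g_mono: "le_star r (g i) (g j)" if "(i, j) \<in> l" for i j
  proof (cases "i = j")
    case True
    then show ?thesis
      using g[of i] that le_refl by (auto simp: Func_def Field_def intro!: le_star_if_le)
  next
    case False
    then show ?thesis
      using g[of j] that by (auto simp: underS_def Field_def)
  qed
  have g_unbounded: "\<not> (\<exists>h\<in>Func \<kappa> \<kappa>. \<forall>i\<in>Field l. le_star r (g i) h)"
  proof
    assume "\<exists>h\<in>Func \<kappa> \<kappa>. \<forall>i\<in>Field l. le_star r (g i) h"
    then obtain h where "h \<in> Func \<kappa> \<kappa>" "\<And>i. i \<in> Field l \<Longrightarrow> le_star r (e i) h"
      using g le_star_trans by blast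
    then show False
      using F(1) e unfolding unbounded_family_def bij_betw_def by blast
  qed
  then show "\<exists>g. (\<forall>i\<in>Field l. g i \<in> Func \<kappa> \<kappa>) \<and> (\<forall>i j. (i, j) \<in> l \<longrightarrow> le_star r (g i) (g j)) \<and>
      \<not> (\<exists>h\<in>Func \<kappa> \<kappa>. \<forall>i\<in>Field l. le_star r (g i) h)"
    using g g_mono by blast
  show "regularCard l"
    unfolding regularCard_def
  proof (intro allI impI)
    fix K assume "K \<subseteq> Field l \<and> cofinal K l"
    then have K: "K \<subseteq> Field l" "\<And>i. i \<in> Field l \<Longrightarrow> \<exists>k\<in>K. (i, k) \<in> l"
      by (auto simp: cofinal_def)
    \<comment> \<open>A bound for the terms indexed by a small cofinal \<open>K\<close> would, by
      monotonicity, bound the entire sequence.\<close>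
    have "\<not> |K| <o l"
    proof
      assume "|K| <o l"
      then obtain h where h: "h \<in> Func \<kappa> \<kappa>" "\<And>k. k \<in> K \<Longrightarrow> le_star r (g k) h"
        using small[of K g] g K(1) by blast
      have "le_star r (g i) h" if i: "i \<in> Field l" for i
      proof -
        obtain k where "k \<in> K" "(i, k) \<in> l"
          using K(2)[OF i] by blast
        then show ?thesis using le_star_trans[OF g_mono h(2)] by blast
      qed
      then show False using g_unbounded h(1) by blast
    qed
    moreover have "|K| \<le>o l"
      using card_of_mono1[OF K(1)] card_of_Field_ordIso[OF assms(1)] by (rule ordLeq_ordIso_trans)
    ultimately show "|K| =o l"
      using ordLeq_iff_ordLess_or_ordIso by blast
  qed
qed

end

section \<open>A stable function for the ultrafilter\<close>

locale countably_complete_uniform_ultrafilter = uncountable_regular_cardinal r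
  for r :: "'k rel" +
  fixes U :: "'k set set"
  assumes ultrafilter: "ultrafilter_on \<kappa> U"
    and countably_complete: "countably_complete U"
    and uniform: "uniform_on r U"
begin

lemma complement_in: "A \<subseteq> \<kappa> \<Longrightarrow> A \<notin> U \<Longrightarrow> \<kappa> - A \<in> U"
  and superset_in: "A \<in> U \<Longrightarrow> A \<subseteq> B \<Longrightarrow> B \<subseteq> \<kappa> \<Longrightarrow> B \<in> U"
  and empty_not_in: "{} \<notin> U"
  and in_Pow: "U \<subseteq> Pow \<kappa>"
  using ultrafilter unfolding ultrafilter_on_def by meson+

text \<open>Countable completeness enters here: infinitely many comparisons can be made at one
  point.\<close>

lemma countable_Inter_nonempty:
  fixes A :: "nat \<Rightarrow> 'k set"
  assumes "\<And>n. A n \<in> U"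
  shows "\<exists>x\<in>\<kappa>. \<forall>n. x \<in> A n"
proof -
  have "(\<Inter>n. A n) \<in> U"
    using countably_complete[unfolded countably_complete_def, rule_format, of "range A"] assms
    by (simp add: image_subset_iff)
  then obtain x where "x \<in> (\<Inter>n. A n)"
    using empty_not_in by (metis ex_in_conv)
  moreover have "A 0 \<subseteq> \<kappa>"
    using assms in_Pow by blast
  ultimately show ?thesis by blast
qed

lemma in_full_subsets: "A \<in> U \<Longrightarrow> A \<in> full_subsets r"
  using in_Pow uniform by (auto simp: uniform_on_def full_subsets_def)

text \<open>The preimage of the club of \<open>g\<close> under the map \<open>h\<close> belonging to
  \<open>g\<^sub>0\<close>.\<close>

definition trace :: "('k \<Rightarrow> 'k) \<Rightarrow> ('k \<Rightarrow> 'k) \<Rightarrow> 'k set" where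
  "trace g\<^sub>0 g = {b\<in>\<kappa>. last_closure_point g\<^sub>0 b \<in> closure_points g}"

text \<open>If no \<open>g\<^sub>0\<close> worked, passing to pointwise maxima would produce functions \<open>G n\<close> whose last closure
  points below a common \<open>b\<close> strictly descend; instead of forming the ultrapower, this argument
  intersects the countably many sets witnessing the descent.\<close>

lemma exists_stable_function:
  "\<exists>g\<^sub>0\<in>Func \<kappa> \<kappa>. \<forall>g\<in>Func \<kappa> \<kappa>. trace g\<^sub>0 g \<in> U"
proof (rule ccontr)
  assume not: "\<not> ?thesis"
  define D where "D g g' = {b\<in>\<kappa>. last_closure_point g' b \<prec> last_closure_point g b}" for g g'
  have "\<exists>g'\<in>Func \<kappa> \<kappa>. D g g' \<in> U" if g: "g \<in> Func \<kappa> \<kappa>" for g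
  proof -
    obtain f where f: "f \<in> Func \<kappa> \<kappa>" "trace g f \<notin> U"
      using not g by blast
    let ?m = "pointwise_max f g"
    have m: "closure_points ?m \<subseteq> closure_points f" "closure_points ?m \<subseteq> closure_points g"
      using pointwise_max_ge[OF f(1) g] closure_points_antimono by blast+
    have "last_closure_point ?m b \<prec> last_closure_point g b" if b: "b \<in> \<kappa> - trace g f" for b
    proof -
      have "last_closure_point ?m b \<preceq> last_closure_point g b"
        using b last_closure_point[of b] m(2) by blast
      \<comment> \<open>Equality would put the last closure point of \<open>g\<close> into the club
        of \<open>f\<close>, and hence \<open>b\<close> into \<open>trace g f\<close>.\<close>
      moreover have "last_closure_point ?m b \<noteq> last_closure_point g b"
        using b last_closure_point(1)[of b ?m] m(1) by (auto simp: trace_def)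
      ultimately show ?thesis by (simp add: lt_iff)
    qed
    then have "\<kappa> - trace g f \<subseteq> D g ?m" "D g ?m \<subseteq> \<kappa>"
      by (auto simp: D_def)
    moreover have "\<kappa> - trace g f \<in> U"
      using complement_in[OF _ f(2)] by (auto simp: trace_def)
    ultimately have "D g ?m \<in> U"
      using superset_in by blast
    then show ?thesis
      using pointwise_max_Func[OF f(1) g] by blast
  qed
  then obtain s where s: "\<And>g. g \<in> Func \<kappa> \<kappa> \<Longrightarrow> s g \<in> Func \<kappa> \<kappa> \<and> D g (s g) \<in> U"
    by metis
  obtain f where f: "f \<in> Func \<kappa> \<kappa>"
    using finite_bounded[of "{}"] by blast
  define G where "G n = (s ^^ n) f" for n
  have "G n \<in> Func \<kappa> \<kappa>" for n
    by (induction n) (use f s in \<open>auto simp: G_def\<close>)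
  then have "D (G n) (G (Suc n)) \<in> U" for n
    using s by (simp add: G_def)
  then obtain b where "b \<in> \<kappa>" "\<And>n. b \<in> D (G n) (G (Suc n))"
    using countable_Inter_nonempty[of "\<lambda>n. D (G n) (G (Suc n))"] by blast
  then have "(last_closure_point (G (Suc n)) b, last_closure_point (G n) b) \<in> r - Id" for n
    by (auto simp: D_def lt_iff)
  then have "\<exists>c. \<forall>n. (c (Suc n), c n) \<in> r - Id"
    by (intro exI[of _ "\<lambda>n. last_closure_point (G n) b"]) simp
  then show False
    using wf unfolding wf_iff_no_infinite_down_chain by blast
qed

definition stable :: "'k \<Rightarrow> 'k" where
  "stable = (SOME g\<^sub>0. g\<^sub>0 \<in> Func \<kappa> \<kappa> \<and> (\<forall>g\<in>Func \<kappa> \<kappa>. trace g\<^sub>0 g \<in> U))"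

lemma stable_Func: "stable \<in> Func \<kappa> \<kappa>"
  and trace_stable_in: "g \<in> Func \<kappa> \<kappa> \<Longrightarrow> trace stable g \<in> U"
proof -
  have "\<exists>g\<^sub>0. g\<^sub>0 \<in> Func \<kappa> \<kappa> \<and> (\<forall>g\<in>Func \<kappa> \<kappa>. trace g\<^sub>0 g \<in> U)"
    using exists_stable_function by blast
  from someI_ex[OF this]
  show "stable \<in> Func \<kappa> \<kappa>" "g \<in> Func \<kappa> \<kappa> \<Longrightarrow> trace stable g \<in> U"
    unfolding stable_def by blast+
qed

section \<open>The projection \<open>h\<close> and the functions it derives from large sets\<close>

abbreviation "project \<equiv> last_closure_point stable"

lemma project_unbounded: "a \<in> \<kappa> \<Longrightarrow> \<exists>b\<in>\<kappa>. \<forall>x. b \<preceq> x \<longrightarrow> a \<prec> project x"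
  by (rule last_closure_point_unbounded) (use stable_Func in \<open>simp_all add: Func_def\<close>)

definition next_point :: "'k set \<Rightarrow> 'k \<Rightarrow> 'k" where
  "next_point Y x = (if x \<in> \<kappa> then SOME z. z \<in> project ` Y \<and> x \<prec> z else undefined)"

text \<open>Past some \<open>b\<close> all values of \<open>project\<close> exceed \<open>x\<close>,
  and a set of size \<kappa> has elements past \<open>b\<close>.\<close>

lemma next_point:
  assumes "Y \<in> full_subsets r" "x \<in> \<kappa>"
  shows "next_point Y x \<in> project ` Y" "x \<prec> next_point Y x"
proof -
  have "\<exists>z. z \<in> project ` Y \<and> x \<prec> z"
    using project_unbounded[OF assms(2)] full_subset_unbounded[OF assms(1)] by blast
  from someI_ex[OF this] show "next_point Y x \<in> project ` Y" "x \<prec> next_point Y x"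
    using assms(2) by (auto simp: next_point_def)
qed

lemma next_point_Func:
  assumes "Y \<in> full_subsets r"
  shows "next_point Y \<in> Func \<kappa> \<kappa>"
proof -
  have "next_point Y x \<in> \<kappa>" if "x \<in> \<kappa>" for x
    using next_point(2)[OF assms that] le_in_Field(2) lt_iff by blast
  moreover have "next_point Y x = undefined" if "x \<notin> \<kappa>" for x
    using that by (simp add: next_point_def)
  ultimately show ?thesis by (simp add: Func_def)
qed

text \<open>The key to both inequalities: for large \<open>x\<close> the next point is a closure
  point of \<open>g\<close> above \<open>x\<close>, hence above \<open>g x\<close>.\<close>

lemma le_star_next_point:
  assumes Y: "Y \<in> full_subsets r" and sub: "almost_subset r Y (trace stable g)"
  shows "le_star r g (next_point Y)"
proof -
  obtain a where a: "a \<in> \<kappa>" "Y - underS r a \<subseteq> trace stable g"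
    using sub unfolding almost_subset_def by blast
  have "g x \<preceq> next_point Y x" if x: "project a \<preceq> x" for x
  proof -
    have "x \<in> \<kappa>" using x le_in_Field by blast
    obtain y where y: "y \<in> Y" "next_point Y x = project y" "x \<prec> project y"
      using next_point[OF Y \<open>x \<in> \<kappa>\<close>] by auto
    \<comment> \<open>This is why the threshold is \<open>project a\<close>: a \<open>y\<close>
      below \<open>a\<close> would give \<open>project y \<preceq> project a \<preceq> x\<close> by
      monotonicity.\<close>
    have "\<not> y \<prec> a"
      using le_lt_trans[OF x y(3)] last_closure_point_mono[of y a stable] le_antisym
      by (auto simp: lt_iff)
    then have "project y \<in> closure_points g"
      using a(2) y(1) by (auto simp: trace_def)
    then show ?thesis
      using y(2,3) by (simp add: closure_points_def lt_iff)
  qed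
  then show ?thesis
    using last_closure_point_in_Field[OF a(1)] unfolding le_star_def by blast
qed

text \<open>Clubs shrink beyond some \<open>c\<close>, and \<open>project\<close> exceeds
  \<open>c\<close> from some \<open>b\<close> on. This makes the tower decreasing.\<close>

lemma trace_almost_antimono:
  assumes "le_star r f g" "f \<in> Func \<kappa> \<kappa>"
  shows "almost_subset r (trace stable g) (trace stable f)"
proof -
  obtain c where c: "c \<in> \<kappa>" "\<And>\<delta>. \<delta> \<in> closure_points g \<Longrightarrow> c \<prec> \<delta> \<Longrightarrow> \<delta> \<in> closure_points f"
    using closure_points_almost_antimono[OF assms(1)] assms(2) by (auto simp: Func_def)
  obtain b where b: "b \<in> \<kappa>" "\<And>x. b \<preceq> x \<Longrightarrow> c \<prec> project x"
    using project_unbounded[OF c(1)] by blast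
  have "trace stable g - underS r b \<subseteq> trace stable f"
  proof
    fix x assume x: "x \<in> trace stable g - underS r b"
    then have "c \<prec> project x"
      using b not_lt by (auto simp: trace_def)
    then show "x \<in> trace stable f"
      using c(2) x by (auto simp: trace_def)
  qed
  then show ?thesis using b(1) unfolding almost_subset_def by blast
qed

section \<open>The two inequalities\<close>

lemma dominating_number_le_pi_character: "dominating_number r \<le>o pi_character r U"
proof -
  have "almost_subset r A A" if "A \<in> U" for A
    using infinite_Field unfolding almost_subset_def by (metis Diff_subset ex_in_conv finite.emptyI)
  \<comment> \<open>Some \<pi>-base exists, so the least size is attained.\<close>
  then have "pi_base r U (full_subsets r)"
    using in_full_subsets unfolding pi_base_def by blast
  then obtain \<B> where B: "pi_base r U \<B>" "pi_character r U = |\<B>|"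
    using least_size(1)[of "pi_base r U"] unfolding pi_character_def by blast
  have "dominating_family r (next_point ` \<B>)"
    unfolding dominating_family_def
  proof (intro conjI ballI)
    show "next_point ` \<B> \<subseteq> Func \<kappa> \<kappa>"
      using B(1) next_point_Func unfolding pi_base_def by blast
    fix g assume "g \<in> Func \<kappa> \<kappa>"
    then show "\<exists>f\<in>next_point ` \<B>. le_star r g f"
      using B(1) trace_stable_in le_star_next_point unfolding pi_base_def by blast
  qed
  then have "dominating_number r \<le>o |next_point ` \<B>|"
    using least_size(2)[of "dominating_family r"] unfolding dominating_number_def by blast
  then show ?thesis
    using B(2) card_of_image ordLeq_transitive by metis
qed

text \<open>The tower consists of the traces of an increasing unbounded sequence; a
  pseudo-intersection \<open>Y\<close> would make \<open>next_point Y\<close> a bound for that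
  sequence.\<close>

lemma tower_length_bounding_number:
  fixes l :: "'l rel"
  assumes "Card_order l" "l =o bounding_number r"
  shows "tower_length r U l"
proof -
  obtain g where g: "\<And>i. i \<in> Field l \<Longrightarrow> g i \<in> Func \<kappa> \<kappa>"
      "\<And>i j. (i, j) \<in> l \<Longrightarrow> le_star r (g i) (g j)"
      "\<not> (\<exists>h\<in>Func \<kappa> \<kappa>. \<forall>i\<in>Field l. le_star r (g i) h)"
    using bounding_scale(3)[OF assms] by blast
  let ?X = "\<lambda>i. trace stable (g i)"
  have "\<not> (\<exists>Y. pseudo_intersection r (Field l) ?X Y)"
    using g(3) le_star_next_point next_point_Func unfolding pseudo_intersection_def by blast
  moreover have "almost_subset r (?X j) (?X i)" if "(i, j) \<in> l" for i j
    using trace_almost_antimono g(1,2) that by (simp add: Field_def Domain.DomainI)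
  ultimately show ?thesis
    unfolding tower_length_def using bounding_scale(1,2)[OF assms] trace_stable_in[OF g(1)]
    by (intro conjI exI[of _ ?X]) simp_all
qed

lemma pi_tightness_le_bounding_number: "\<exists>t. is_pi_tightness r U t \<and> t \<le>o bounding_number r"
proof -
  obtain F where F: "bounding_number r = |F|"
    using least_size(1)[of "unbounded_family r", OF unbounded_family_Func]
    unfolding bounding_number_def by blast
  have "tower_length r U |F|"
    by (rule tower_length_bounding_number) (simp_all add: F card_of_Card_order card_of_refl)
  \<comment> \<open>\<open>F\<close> consists of functions, whereas lengths are compared on
    \<open>'k set\<close>. The size bound permits a copy \<open>B\<close> of the cardinal on that
    type.\<close>
  then have "|F| \<le>o |UNIV :: 'k set set|"
    by (rule tower_length_le[OF in_Pow uniform])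
  then obtain B :: "'k set set" where "|B| =o bounding_number r"
    using internalize_card_of_ordLeq2[THEN iffD1] ordIso_symmetric F by metis
  then have B: "tower_length r U |B|" "|B| =o bounding_number r"
    using tower_length_bounding_number card_of_Card_order by blast+
  have "\<forall>l\<in>Collect (tower_length r U). Card_order l"
    by (auto simp: tower_length_def)
  then obtain t :: "'k set rel" where t: "tower_length r U t" "\<And>l :: 'k set rel. tower_length r U l \<Longrightarrow> t \<le>o l"
    using exists_minim_Card_order[of "Collect (tower_length r U) :: 'k set rel set"] B(1) by auto
  then show ?thesis
    using B ordLeq_ordIso_trans unfolding is_pi_tightness_def by blast
qed

end

theorem theorem2p21:
  fixes r :: "'k rel" and U :: "'k set set"
  assumes "uncountable_regular r"
    and "ultrafilter_on (Field r) U"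
    and "countably_complete U"
    and "uniform_on r U"
  shows "dominating_number r \<le>o pi_character r U \<and>
         (\<exists>t. is_pi_tightness r U t \<and> t \<le>o bounding_number r)"
proof -
  interpret countably_complete_uniform_ultrafilter r U
    using assms by unfold_locales
  show ?thesis
    using dominating_number_le_pi_character pi_tightness_le_bounding_number by blast
qed

end
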